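(* Let $s\ge1$, let $a_{ij},b_i\in\mathbb{R}$ $(i,j=1,\dots,s)$, and let $c_i=\sum_{j=1}^s a_{ij}$ be distinct. Let $(\phi^n,p^n)\in\mathbb{C}^{N_xN_y}\times\mathbb{R}$, $n=0,1,2,\dots$, be produced, from given $(\phi^0,p^0)$ and time step $\tau>0$, by the $s$-stage linearly implicit integrating factor Runge-Kutta method: for $i=1,\dots,s$, $$\phi_{ni}=\exp(\mathrm{i}\mathcal{L}_hc_i\tau)\phi^n+\tau\sum_{j=1}^s a_{ij}\exp(\mathrm{i}\mathcal{L}_h(c_i-c_j)\tau)k_j,\qquad p_{ni}=p^n+\tau\sum_{j=1}^s a_{ij}l_j,$$ $$k_i=\mathrm{i}\,\frac{\beta|\phi_{ni}^*|^2\cdot\phi_{ni}^*\,p_{ni}}{\sqrt{\langle(\phi_{ni}^* )^2,(\phi_{ni}^* )^2\rangle_h+C_0}},\qquad l_i=2\,\mathrm{Re}\Big\langle\mathrm{i}\mathcal{L}_h\phi_{ni},\frac{|\phi_{ni}^*|^2\cdot\phi_{ni}^*}{\sqrt{\langle(\phi_{ni}^* )^2,(\phi_{ni}^* )^2\rangle_h+C_0}}\Big\rangle_h,$$ and $$\phi^{n+1}=\exp(\mathrm{i}\mathcal{L}_h\tau)\phi^n+\tau\sum_{i=1}^s b_i\exp(\mathrm{i}\mathcal{L}_h(1-c_i)\tau)k_i,\qquad p^{n+1}=p^n+\tau\sum_{i=1}^s b_il_i,$$ where $\phi_{ni}^*=\mathcal{P}(t_n+c_i\tau)$ are the given extrapolated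 values described in the context. If $$b_ia_{ij}+b_ja_{ji}=b_ib_j\qquad\text{for all } i,j=1,\dots,s,$$ then the scheme preserves the discrete quadratic energy: $E_h^n=E_h^0$ for all $n=0,1,2,\dots$, where $$E_h^n=\langle\mathcal{L}_h\phi^n,\phi^n\rangle_h+\frac{\beta}{2}(p^n)^2-\frac{\beta}{2}C_0 .$$
   Context: Let $\Omega=[a,b]\times[c,d]$, $l_x=b-a$, $l_y=d-c$, let $N_x,N_y$ be even positive integers, $h_x=l_x/N_x$, $h_y=l_y/N_y$, $x_j=jh_x$, $y_k=kh_y$, $\mu_x=2\pi/l_x$, $\mu_y=2\pi/l_y$. Grid functions $(\phi_{j,k})$, $0\le j\le N_x-1$, $0\le k\le N_y-1$, are identified with vectors in $\mathbb{C}^{N_xN_y}$ (index $j$ running fastest). The discrete inner product is $\langle\phi,\psi\rangle_h=h_xh_y\sum_{j=0}^{N_x-1}\sum_{k=0}^{N_y-1}\phi_{j,k}\bar\psi_{j,k}$. The symbol $\cdot$ is the entrywise product, $\phi^2=\phi\cdot\phi$, $|\phi|^2=\phi\cdot\bar\phi$. The spectral differentiation matrix is $\mathcal{L}_h=I_{N_y}\otimes D_2^x+D_2^y\otimes I_{N_x}$ ($\otimes$ the Kronecker product, $I_N$ the identity), where $D_2^x\in\mathbb{R}^{N_x\times N_x}$ has entries $$(D_2^x)_{j,k}=\tfrac12\mu_x^2(-1)^{j+k+1}\csc^2\Big(\mu_x\frac{x_j-x_k}{2}\Big)\ (j\ne k),\qquad (D_2^x)_{j,j}=-\mu_x^2\frac{N_x^2+2}{12},$$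 and $D_2^y\in\mathbb{R}^{N_y\times N_y}$ is defined in the same way with $x$ replaced by $y$. $\exp$ is the matrix exponential. $\beta\in\mathbb{R}$ is a constant, and $C_0\ge0$ is a constant such that the quantities under the square roots are positive. $t_n=n\tau$. For each $n$, $\mathcal{P}(t)$ is the $\mathbb{C}^{N_xN_y}$-valued Lagrange interpolating polynomial through already computed data, i.e. data taken among $(t_k,\phi^k)$, $0\le k\le n$, and $(t_k+c_i\tau,\phi_{ki})$, $0\le k\le n-1$, $1\le i\le s$ (a nonempty selection with pairwise distinct time nodes); the vectors $\phi_{ni}^*$ are thus known when step $n$ is performed. The stage equations are assumed to be solved by $(\phi_{ni},p_{ni},k_i,l_i)$ at every step. *)

theory Defs
  imports
    "HOL-Analysis.Analysis"
    "Jordan_Normal_Form.Matrix"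
    "Jordan_Normal_Form.Conjugate"
begin

definition kronecker :: "'a::times mat \<Rightarrow> 'a mat \<Rightarrow> 'a mat" (infixl "\<otimes>\<^sub>K" 70) where
  "A \<otimes>\<^sub>K B = mat (dim_row A * dim_row B) (dim_col A * dim_col B)
     (\<lambda>(i, j). A $$ (i div dim_row B, j div dim_col B) * B $$ (i mod dim_row B, j mod dim_col B))"

(* The exponential series, summed entrywise; it converges absolutely for every square matrix. *)
definition mat_exp :: "complex mat \<Rightarrow> complex mat" where
  "mat_exp A = mat (dim_row A) (dim_row A) (\<lambda>(i, j). \<Sum>k. (A ^\<^sub>m k) $$ (i, j) / fact k)"

definition entrywise_mult :: "complex vec \<Rightarrow> complex vec \<Rightarrow> complex vec" (infixl "\<odot>" 72) where
  "u \<odot> v = vec (dim_vec u) (\<lambda>r. u $ r * v $ r)"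

(* Throughout, lx, ly are the side lengths of the rectangle.  The scheme depends on the
   rectangle only through them, since the grid points enter only via their differences. *)

definition grid_pt :: "real \<Rightarrow> nat \<Rightarrow> nat \<Rightarrow> real" where
  "grid_pt l N j = real j * (l / real N)"

definition spectral_D2 :: "real \<Rightarrow> nat \<Rightarrow> real mat" where
  "spectral_D2 l N = (let \<mu> = 2 * pi / l in mat N N (\<lambda>(j, k).
     if j = k then - (\<mu>\<^sup>2 * ((real N)\<^sup>2 + 2) / 12)
     else 1 / 2 * \<mu>\<^sup>2 * (-1) ^ (j + k + 1)
            * (1 / sin (\<mu> * ((grid_pt l N j - grid_pt l N k) / 2)))\<^sup>2))"

definition spectral_Lap :: "real \<Rightarrow> real \<Rightarrow> nat \<Rightarrow> nat \<Rightarrow> complex mat" where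
  "spectral_Lap lx ly Nx Ny = map_mat complex_of_real
     (1\<^sub>m Ny \<otimes>\<^sub>K spectral_D2 lx Nx + spectral_D2 ly Ny \<otimes>\<^sub>K 1\<^sub>m Nx)"

(* The grid value with indices (j, k) is stored at position j + k * Nx. *)
definition grid_inner ::
  "real \<Rightarrow> real \<Rightarrow> nat \<Rightarrow> nat \<Rightarrow> complex vec \<Rightarrow> complex vec \<Rightarrow> complex" where
  "grid_inner lx ly Nx Ny \<phi> \<psi> = complex_of_real (lx / real Nx * (ly / real Ny)) *
     (\<Sum>j<Nx. \<Sum>k<Ny. \<phi> $ (j + k * Nx) * cnj (\<psi> $ (j + k * Nx)))"

lemma Im_grid_inner_self: "Im (grid_inner lx ly Nx Ny \<phi> \<phi>) = 0"
  by (simp add: grid_inner_def)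

(* The quantity under the square root; by Im_grid_inner_self, taking Re loses nothing. *)
definition radicand ::
  "real \<Rightarrow> real \<Rightarrow> nat \<Rightarrow> nat \<Rightarrow> real \<Rightarrow> complex vec \<Rightarrow> real" where
  "radicand lx ly Nx Ny C0 \<phi> = Re (grid_inner lx ly Nx Ny (\<phi> \<odot> \<phi>) (\<phi> \<odot> \<phi>)) + C0"

definition normalized_cubic ::
  "real \<Rightarrow> real \<Rightarrow> nat \<Rightarrow> nat \<Rightarrow> real \<Rightarrow> complex vec \<Rightarrow> complex vec" where
  "normalized_cubic lx ly Nx Ny C0 \<phi> =
     complex_of_real (1 / sqrt (radicand lx ly Nx Ny C0 \<phi>)) \<cdot>\<^sub>v ((\<phi> \<odot> conjugate \<phi>) \<odot> \<phi>)"

(* Complex-valued because the inner product is. *)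
definition grid_energy ::
  "real \<Rightarrow> real \<Rightarrow> nat \<Rightarrow> nat \<Rightarrow> real \<Rightarrow> real \<Rightarrow> complex vec \<Rightarrow> real \<Rightarrow> complex" where
  "grid_energy lx ly Nx Ny \<beta> C0 \<phi> p =
     grid_inner lx ly Nx Ny (spectral_Lap lx ly Nx Ny *\<^sub>v \<phi>) \<phi>
       + complex_of_real (\<beta> / 2 * p\<^sup>2) - complex_of_real (\<beta> / 2 * C0)"

(* Value at t of the interpolating polynomial through the points (tm x, vl x), x in S,
   with values in complex m-space. *)
definition lagrange_interp ::
  "nat \<Rightarrow> 'i set \<Rightarrow> ('i \<Rightarrow> real) \<Rightarrow> ('i \<Rightarrow> complex vec) \<Rightarrow> real \<Rightarrow> complex vec" where
  "lagrange_interp m S tm vl t = finsum_vec TYPE(complex) m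
     (\<lambda>x. complex_of_real (\<Prod>y\<in>S - {x}. (t - tm y) / (tm x - tm y)) \<cdot>\<^sub>v vl x) S"

(* Labels of the computed data: Step_data k stands for (t_k, phi^k) and
   Stage_data k i for (t_k + c_i tau, phi_{ki}). *)
datatype data_label = Step_data nat | Stage_data nat nat

fun data_time :: "real \<Rightarrow> (nat \<Rightarrow> real) \<Rightarrow> data_label \<Rightarrow> real" where
  "data_time \<tau> c (Step_data k) = real k * \<tau>"
| "data_time \<tau> c (Stage_data k i) = real k * \<tau> + c i * \<tau>"

fun data_value ::
  "(nat \<Rightarrow> complex vec) \<Rightarrow> (nat \<Rightarrow> nat \<Rightarrow> complex vec) \<Rightarrow> data_label \<Rightarrow> complex vec" where
  "data_value \<phi> \<Phi> (Step_data k) = \<phi> k"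
| "data_value \<phi> \<Phi> (Stage_data k i) = \<Phi> k i"

definition available_data :: "nat \<Rightarrow> nat \<Rightarrow> data_label set" where
  "available_data s n = {Step_data k |k. k \<le> n} \<union> {Stage_data k i |k i. k < n \<and> i \<in> {1..s}}"

end

theory Submission
  imports Defs
begin

text \<open>
  In the integrating-factor variables \<open>w\<^sub>i = exp(-i L c\<^sub>i \<tau>) k\<^sub>i\<close> the scheme is a plain Runge-Kutta
  step, up to the unitary factors \<open>exp(i L \<theta>)\<close>. These factors commute with \<open>L\<close>, so they leave the
  quadratic form \<open>\<langle>L u, u\<rangle>\<close> unchanged. The condition on the weights cancels all terms of second
  order in \<open>\<tau>\<close> in the increments of \<open>\<langle>L \<phi>, \<phi>\<rangle>\<close> and of \<open>p\<^sup>2\<close>. The remaining terms,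
  \<open>2 \<tau> b\<^sub>i Re \<langle>L \<phi>\<^sub>n\<^sub>i, k\<^sub>i\<rangle>\<close> and \<open>\<beta> \<tau> b\<^sub>i p\<^sub>n\<^sub>i l\<^sub>i\<close>, add up to zero for each stage separately,
  whatever the extrapolated values are.
\<close>

subsection \<open>The matrix exponential\<close>

lemma pow_mat_add:
  assumes "A \<in> carrier_mat n n"
  shows "A ^\<^sub>m (k + l) = A ^\<^sub>m k * A ^\<^sub>m l"
proof (induction l)
  case (Suc l)
  then show ?case
    using assms by (simp add: assoc_mult_mat[of _ n n _ n _ n])
qed (use assms in simp)

lemma pow_mat_Suc_left:
  assumes "A \<in> carrier_mat n n"
  shows "A ^\<^sub>m Suc k = A * A ^\<^sub>m k"
  using pow_mat_add[OF assms, of 1 k] assms by simp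

lemma pow_mat_smult:
  fixes A :: "'a::comm_semiring_1 mat"
  assumes "A \<in> carrier_mat n n"
  shows "(z \<cdot>\<^sub>m A) ^\<^sub>m k = z ^ k \<cdot>\<^sub>m A ^\<^sub>m k"
proof (induction k)
  case (Suc k)
  then show ?case
    using assms
    by (intro eq_matI) (auto simp: scalar_prod_def sum_distrib_left ac_simps intro!: sum.cong)
qed (use assms in \<open>auto intro!: eq_matI\<close>)

lemma index_mult_mat_sum:
  assumes "A \<in> carrier_mat nr n" "B \<in> carrier_mat n nc" "i < nr" "j < nc"
  shows "(A * B) $$ (i, j) = (\<Sum>l<n. A $$ (i, l) * B $$ (l, j))"
  using assms by (simp add: scalar_prod_def lessThan_atLeast0)

text \<open>Every further factor \<open>A\<close> turns an entry into a sum of \<open>n\<close>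
  products, so it costs at most a factor \<open>n * M\<close>. This geometric growth is what makes
  the exponential series comparable with a scalar one.\<close>

lemma norm_pow_mat_entry_le:
  fixes A :: "'a::real_normed_field mat"
  assumes A: "A \<in> carrier_mat n n" and M: "\<And>i j. i < n \<Longrightarrow> j < n \<Longrightarrow> norm (A $$ (i, j)) \<le> M"
    and "i < n" "j < n"
  shows "norm ((A ^\<^sub>m k) $$ (i, j)) \<le> (real n * M) ^ k"
  using \<open>j < n\<close>
proof (induction k arbitrary: j)
  case 0
  then show ?case
    using A \<open>i < n\<close> by simp
next
  case (Suc k)
  have "norm ((A ^\<^sub>m Suc k) $$ (i, j)) = norm (\<Sum>l<n. (A ^\<^sub>m k) $$ (i, l) * A $$ (l, j))"
    using A \<open>i < n\<close> Suc.prems index_mult_mat_sum[of "A ^\<^sub>m k" n n A n i j] by simp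
  also have "\<dots> \<le> (\<Sum>l<n. (real n * M) ^ k * M)"
    using Suc M by (intro sum_norm_le) (auto simp: norm_mult intro!: mult_mono' order_trans[OF norm_ge_zero])
  finally show ?case
    by (simp add: ac_simps)
qed

lemma mat_exp_carrier [simp]:
  assumes "A \<in> carrier_mat n n"
  shows "mat_exp A \<in> carrier_mat n n"
  using assms by (simp add: mat_exp_def)

text \<open>Absolute convergence is proved, rather than mere convergence, because the Cauchy product
  of two such series is taken later.\<close>

lemma mat_exp_entry_summable:
  fixes A :: "complex mat"
  assumes A: "A \<in> carrier_mat n n" and "i < n" "j < n"
  shows "summable (\<lambda>k. norm (z ^ k / fact k * (A ^\<^sub>m k) $$ (i, j)))"
proof -
  \<comment> \<open>The sum of all entry moduli bounds each of them, and it makes sense for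
    \<open>n = 0\<close> as well, where a maximum would not.\<close>
  define M where "M = (\<Sum>i<n. \<Sum>j<n. norm (A $$ (i, j)))"
  have M: "norm (A $$ (i, j)) \<le> M" if "i < n" "j < n" for i j
  proof -
    have "norm (A $$ (i, j)) \<le> (\<Sum>j<n. norm (A $$ (i, j)))"
      using that by (intro member_le_sum) auto
    also have "\<dots> \<le> M"
      unfolding M_def using that
      by (intro member_le_sum[where f = "\<lambda>i. \<Sum>j<n. norm (A $$ (i, j))"]) (auto intro: sum_nonneg)
    finally show ?thesis .
  qed
  show ?thesis
  proof (rule summable_comparison_test[OF _ summable_exp[of "norm z * (real n * M)"]], intro exI allI impI)
    fix k
    have "norm ((A ^\<^sub>m k) $$ (i, j)) \<le> (real n * M) ^ k"
      using norm_pow_mat_entry_le[OF A M] assms by blast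
    then have "norm z ^ k * norm ((A ^\<^sub>m k) $$ (i, j)) \<le> norm z ^ k * (real n * M) ^ k"
      by (intro mult_left_mono) auto
    then show "norm (norm (z ^ k / fact k * (A ^\<^sub>m k) $$ (i, j)))
        \<le> inverse (fact k) * (norm z * (real n * M)) ^ k"
      by (simp add: norm_mult norm_divide norm_power power_mult_distrib field_simps)
  qed
qed

text \<open>With \<open>A\<close> fixed, each entry is a power series in \<open>z\<close>. The
  identities for the exponential below are all obtained by comparing such series entry by
  entry.\<close>

lemma mat_exp_smult_sums:
  fixes A :: "complex mat"
  assumes A: "A \<in> carrier_mat n n" and "i < n" "j < n"
  shows "(\<lambda>k. z ^ k / fact k * (A ^\<^sub>m k) $$ (i, j)) sums mat_exp (z \<cdot>\<^sub>m A) $$ (i, j)"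
proof -
  have "mat_exp (z \<cdot>\<^sub>m A) $$ (i, j) = (\<Sum>k. z ^ k / fact k * (A ^\<^sub>m k) $$ (i, j))"
    using assms by (simp add: mat_exp_def pow_mat_smult[OF A])
  with mat_exp_entry_summable[OF assms, of z] show ?thesis
    by (metis summable_norm_cancel summable_sums)
qed

lemma mat_exp_zero_smult:
  fixes A :: "complex mat"
  assumes A: "A \<in> carrier_mat n n"
  shows "mat_exp (0 \<cdot>\<^sub>m A) = 1\<^sub>m n"
proof (rule eq_matI)
  fix i j assume "i < dim_row (1\<^sub>m n)" "j < dim_col (1\<^sub>m n)"
  then have ij: "i < n" "j < n" by auto
  \<comment> \<open>Since \<open>0 ^ 0 = 1\<close>, exactly the term with \<open>k = 0\<close>
    survives.\<close>
  have "(\<lambda>k. 0 ^ k / fact k * (A ^\<^sub>m k) $$ (i, j)) sums (A ^\<^sub>m 0) $$ (i, j)"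
    using powser_sums_zero[of "\<lambda>k. (A ^\<^sub>m k) $$ (i, j) / fact k"] by (simp add: ac_simps)
  with mat_exp_smult_sums[OF A ij, of 0] show "mat_exp (0 \<cdot>\<^sub>m A) $$ (i, j) = 1\<^sub>m n $$ (i, j)"
    using A ij by (simp add: sums_unique2)
qed (use A in \<open>auto simp: mat_exp_def\<close>)

text \<open>Powers of one matrix commute, so the scalar proof carries over: multiply the series by
  the Cauchy product and collect terms with the binomial theorem.\<close>

lemma mat_exp_add_smult:
  fixes A :: "complex mat"
  assumes A: "A \<in> carrier_mat n n"
  shows "mat_exp ((x + y) \<cdot>\<^sub>m A) = mat_exp (x \<cdot>\<^sub>m A) * mat_exp (y \<cdot>\<^sub>m A)"
proof (rule eq_matI)
  fix i j assume "i < dim_row (mat_exp (x \<cdot>\<^sub>m A) * mat_exp (y \<cdot>\<^sub>m A))"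
    "j < dim_col (mat_exp (x \<cdot>\<^sub>m A) * mat_exp (y \<cdot>\<^sub>m A))"
  then have ij: "i < n" "j < n"
    using A by (auto simp: mat_exp_def)
  let ?t = "\<lambda>z k i j. z ^ k / fact k * (A ^\<^sub>m k) $$ (i, j)"
  \<comment> \<open>One Cauchy product for each inner index \<open>l\<close> of the matrix product;
    the finite sum over \<open>l\<close> is taken afterwards.\<close>
  have "(\<lambda>k. \<Sum>r\<le>k. ?t x r i l * ?t y (k - r) l j) sums
      (mat_exp (x \<cdot>\<^sub>m A) $$ (i, l) * mat_exp (y \<cdot>\<^sub>m A) $$ (l, j))" if "l < n" for l
    using Cauchy_product_sums[OF mat_exp_entry_summable[OF A ij(1) that, of x]
        mat_exp_entry_summable[OF A that ij(2), of y]]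
    by (simp only: sums_unique[OF mat_exp_smult_sums[OF A ij(1) that]]
        sums_unique[OF mat_exp_smult_sums[OF A that ij(2)]])
  then have "(\<lambda>k. \<Sum>l<n. \<Sum>r\<le>k. ?t x r i l * ?t y (k - r) l j) sums
      (\<Sum>l<n. mat_exp (x \<cdot>\<^sub>m A) $$ (i, l) * mat_exp (y \<cdot>\<^sub>m A) $$ (l, j))"
    by (intro sums_sum) auto
  also have "(\<lambda>k. \<Sum>l<n. \<Sum>r\<le>k. ?t x r i l * ?t y (k - r) l j) = (\<lambda>k. ?t (x + y) k i j)"
  proof
    fix k
    have "(\<Sum>l<n. \<Sum>r\<le>k. ?t x r i l * ?t y (k - r) l j) =
        (\<Sum>r\<le>k. \<Sum>l<n. ?t x r i l * ?t y (k - r) l j)"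
      by (rule sum.swap)
    also have "\<dots> = (\<Sum>r\<le>k. x ^ r / fact r * (y ^ (k - r) / fact (k - r)) * (A ^\<^sub>m k) $$ (i, j))"
    proof (rule sum.cong)
      fix r assume "r \<in> {..k}"
      then have "A ^\<^sub>m k = A ^\<^sub>m r * A ^\<^sub>m (k - r)"
        using pow_mat_add[OF A, of r "k - r"] by simp
      then have "(A ^\<^sub>m k) $$ (i, j) = (\<Sum>l<n. (A ^\<^sub>m r) $$ (i, l) * (A ^\<^sub>m (k - r)) $$ (l, j))"
        using index_mult_mat_sum[of "A ^\<^sub>m r" n n "A ^\<^sub>m (k - r)" n i j] A ij by simp
      then show "(\<Sum>l<n. ?t x r i l * ?t y (k - r) l j) =
          x ^ r / fact r * (y ^ (k - r) / fact (k - r)) * (A ^\<^sub>m k) $$ (i, j)"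
        by (simp add: sum_distrib_left ac_simps)
    qed simp
    \<comment> \<open>The two factorials combine to a binomial coefficient over
      \<open>fact k\<close>, which prepares the binomial theorem.\<close>
    also have "\<dots> = (\<Sum>r\<le>k. of_nat (k choose r) * x ^ r * y ^ (k - r)) / fact k * (A ^\<^sub>m k) $$ (i, j)"
      unfolding sum_divide_distrib sum_distrib_right
      by (auto simp: binomial_fact field_simps intro!: sum.cong)
    finally show "(\<Sum>l<n. \<Sum>r\<le>k. ?t x r i l * ?t y (k - r) l j) = ?t (x + y) k i j"
      by (simp add: binomial_ring)
  qed
  finally show "mat_exp ((x + y) \<cdot>\<^sub>m A) $$ (i, j) = (mat_exp (x \<cdot>\<^sub>m A) * mat_exp (y \<cdot>\<^sub>m A)) $$ (i, j)"
    using mat_exp_smult_sums[OF A ij, of "x + y"] A ij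
    by (subst index_mult_mat_sum[of _ n n _ n]) (auto intro: sums_unique2)
qed (use A in \<open>auto simp: mat_exp_def\<close>)

lemma mat_exp_smult_commute:
  fixes A :: "complex mat"
  assumes A: "A \<in> carrier_mat n n"
  shows "A * mat_exp (z \<cdot>\<^sub>m A) = mat_exp (z \<cdot>\<^sub>m A) * A"
proof (rule eq_matI)
  fix i j assume "i < dim_row (mat_exp (z \<cdot>\<^sub>m A) * A)" "j < dim_col (mat_exp (z \<cdot>\<^sub>m A) * A)"
  then have ij: "i < n" "j < n"
    using A by (auto simp: mat_exp_def)
  have "(\<lambda>k. \<Sum>l<n. A $$ (i, l) * (z ^ k / fact k * (A ^\<^sub>m k) $$ (l, j))) sums
      (A * mat_exp (z \<cdot>\<^sub>m A)) $$ (i, j)"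
    using A ij
    by (subst index_mult_mat_sum[of _ n n _ n]) (auto intro!: sums_sum sums_mult mat_exp_smult_sums simp del: times_divide_eq_left times_divide_eq_right)
  moreover have "(\<lambda>k. \<Sum>l<n. (z ^ k / fact k * (A ^\<^sub>m k) $$ (i, l)) * A $$ (l, j)) sums
      (mat_exp (z \<cdot>\<^sub>m A) * A) $$ (i, j)"
    using A ij
    by (subst index_mult_mat_sum[of _ n n _ n]) (auto intro!: sums_sum sums_mult2 mat_exp_smult_sums simp del: times_divide_eq_left times_divide_eq_right)
  \<comment> \<open>Up to the scalar factor, both sides are the \<open>(i, j)\<close> entry of the
    power \<open>Suc k\<close> of \<open>A\<close>, with the extra factor split off on the left or
    on the right.\<close>
  moreover have "(\<Sum>l<n. A $$ (i, l) * (z ^ k / fact k * (A ^\<^sub>m k) $$ (l, j))) =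
      (\<Sum>l<n. (z ^ k / fact k * (A ^\<^sub>m k) $$ (i, l)) * A $$ (l, j))" for k
  proof -
    have "(\<Sum>l<n. A $$ (i, l) * (A ^\<^sub>m k) $$ (l, j)) = (\<Sum>l<n. (A ^\<^sub>m k) $$ (i, l) * A $$ (l, j))"
      using index_mult_mat_sum[of A n n "A ^\<^sub>m k" n i j] index_mult_mat_sum[of "A ^\<^sub>m k" n n A n i j]
        pow_mat_Suc_left[OF A, of k] A ij by (simp del: index_mult_mat(1))
    then have "z ^ k / fact k * (\<Sum>l<n. A $$ (i, l) * (A ^\<^sub>m k) $$ (l, j)) =
        z ^ k / fact k * (\<Sum>l<n. (A ^\<^sub>m k) $$ (i, l) * A $$ (l, j))"
      by simp
    then show ?thesis
      by (simp add: sum_distrib_left ac_simps)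
  qed
  ultimately show "(A * mat_exp (z \<cdot>\<^sub>m A)) $$ (i, j) = (mat_exp (z \<cdot>\<^sub>m A) * A) $$ (i, j)"
    by (simp add: sums_unique2)
qed (use A in \<open>auto simp: mat_exp_def\<close>)

lemma pow_mat_hermitian:
  fixes A :: "complex mat"
  assumes A: "A \<in> carrier_mat n n"
    and herm: "\<And>i j. i < n \<Longrightarrow> j < n \<Longrightarrow> A $$ (j, i) = cnj (A $$ (i, j))"
    and "i < n" "j < n"
  shows "(A ^\<^sub>m k) $$ (j, i) = cnj ((A ^\<^sub>m k) $$ (i, j))"
  using \<open>i < n\<close> \<open>j < n\<close>
proof (induction k arbitrary: i j)
  case 0
  then show ?case
    using A by simp
next
  case (Suc k)
  \<comment> \<open>Conjugate transposition reverses products: the extra factor is split off on the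
    left here and reassembled on the right at the end.\<close>
  have "(A ^\<^sub>m Suc k) $$ (j, i) = (\<Sum>l<n. A $$ (j, l) * (A ^\<^sub>m k) $$ (l, i))"
    using index_mult_mat_sum[of A n n "A ^\<^sub>m k" n j i] pow_mat_Suc_left[OF A, of k] A Suc.prems by simp
  also have "\<dots> = (\<Sum>l<n. cnj ((A ^\<^sub>m k) $$ (i, l) * A $$ (l, j)))"
  proof (rule sum.cong)
    fix l assume "l \<in> {..<n}"
    then show "A $$ (j, l) * (A ^\<^sub>m k) $$ (l, i) = cnj ((A ^\<^sub>m k) $$ (i, l) * A $$ (l, j))"
      using Suc.IH[of i l] Suc.prems herm[of l j] by simp
  qed simp
  also have "\<dots> = cnj ((A ^\<^sub>m Suc k) $$ (i, j))"
    using index_mult_mat_sum[of "A ^\<^sub>m k" n n A n i j] A Suc.prems by simp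
  finally show ?case .
qed

text \<open>Powers of a Hermitian matrix are Hermitian, so conjugating the series termwise only
  conjugates \<open>z\<close>. In matrix terms, the adjoint of the exponential of \<open>z\<close>
  times \<open>A\<close> is the exponential of \<open>cnj z\<close> times \<open>A\<close>.\<close>

lemma mat_exp_smult_hermitian:
  fixes A :: "complex mat"
  assumes A: "A \<in> carrier_mat n n"
    and herm: "\<And>i j. i < n \<Longrightarrow> j < n \<Longrightarrow> A $$ (j, i) = cnj (A $$ (i, j))"
    and ij: "i < n" "j < n"
  shows "mat_exp (cnj z \<cdot>\<^sub>m A) $$ (j, i) = cnj (mat_exp (z \<cdot>\<^sub>m A) $$ (i, j))"
proof -
  have "(\<lambda>k. cnj (z ^ k / fact k * (A ^\<^sub>m k) $$ (i, j))) sums cnj (mat_exp (z \<cdot>\<^sub>m A) $$ (i, j))"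
    using mat_exp_smult_sums[OF A ij] by (simp only: sums_cnj)
  moreover have "cnj (z ^ k / fact k * (A ^\<^sub>m k) $$ (i, j)) =
      cnj z ^ k / fact k * (A ^\<^sub>m k) $$ (j, i)" for k
    using pow_mat_hermitian[OF A herm ij] by simp
  ultimately have "(\<lambda>k. cnj z ^ k / fact k * (A ^\<^sub>m k) $$ (j, i)) sums
      cnj (mat_exp (z \<cdot>\<^sub>m A) $$ (i, j))"
    by (simp only:)
  then show ?thesis
    by (rule sums_unique2[OF mat_exp_smult_sums[OF A ij(2) ij(1)]])
qed

section \<open>Adjoints, and matrices applied to vector sums\<close>

text \<open>Adjointness is stated through entries. It serves both for \<open>B = A\<close> with
  \<open>A\<close> Hermitian and for a pair of exponentials with opposite imaginary
  arguments.\<close>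

lemma cscalar_prod_mult_mat_vec:
  fixes A B :: "complex mat"
  assumes A: "A \<in> carrier_mat n n" and B: "B \<in> carrier_mat n n"
    and adj: "\<And>i j. i < n \<Longrightarrow> j < n \<Longrightarrow> B $$ (j, i) = cnj (A $$ (i, j))"
    and u: "u \<in> carrier_vec n" and v: "v \<in> carrier_vec n"
  shows "(A *\<^sub>v u) \<bullet>c v = u \<bullet>c (B *\<^sub>v v)"
proof -
  have "(A *\<^sub>v u) \<bullet>c v = (\<Sum>i<n. \<Sum>j<n. A $$ (i, j) * u $ j * cnj (v $ i))"
    using A u v by (simp add: scalar_prod_def lessThan_atLeast0 sum_distrib_right)
  also have "\<dots> = (\<Sum>j<n. \<Sum>i<n. A $$ (i, j) * u $ j * cnj (v $ i))"
    by (rule sum.swap)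
  also have "\<dots> = (\<Sum>j<n. u $ j * (\<Sum>i<n. cnj (B $$ (j, i) * v $ i)))"
    using adj by (auto simp: sum_distrib_left ac_simps intro!: sum.cong)
  also have "\<dots> = u \<bullet>c (B *\<^sub>v v)"
    using B u v by (simp add: scalar_prod_def lessThan_atLeast0)
  finally show ?thesis .
qed

text \<open>The congruence rule for finite products in a commutative monoid, read in the additive
  monoid of vectors.\<close>

lemmas finsum_vec_cong =
  comm_monoid.finprod_cong'[OF comm_monoid_vec, folded finsum_vec_def, unfolded monoid_vec_simps]

text \<open>Linearity in the shape that a Runge-Kutta stage or step has, so that an exponential can
  be moved inside it at once.\<close>

lemma mult_mat_vec_add_smult_finsum:
  fixes A :: "complex mat"
  assumes A: "A \<in> carrier_mat n n" and u: "u \<in> carrier_vec n" and "finite S"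
    and f: "\<And>x. x \<in> S \<Longrightarrow> f x \<in> carrier_vec n"
  shows "A *\<^sub>v (u + z \<cdot>\<^sub>v finsum_vec TYPE(complex) n f S) =
    A *\<^sub>v u + z \<cdot>\<^sub>v finsum_vec TYPE(complex) n (\<lambda>x. A *\<^sub>v f x) S"
proof -
  have "A *\<^sub>v finsum_vec TYPE(complex) n f S = finsum_vec TYPE(complex) n (\<lambda>x. A *\<^sub>v f x) S"
    using \<open>finite S\<close> f
  proof (induction S rule: finite_induct)
    case empty
    then show ?case
      using A by (auto simp: finsum_vec_empty)
  next
    case (insert x S)
    then have x: "f x \<in> carrier_vec n" and fS: "f \<in> S \<rightarrow> carrier_vec n"
      by auto
    moreover have "A *\<^sub>v f x \<in> carrier_vec n" "(\<lambda>x. A *\<^sub>v f x) \<in> S \<rightarrow> carrier_vec n"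
      using A x fS by (auto intro!: mult_mat_vec_carrier)
    ultimately show ?case
      using insert mult_add_distrib_mat_vec[OF A x finsum_vec_closed[OF fS]]
      by (simp add: finsum_vec_insert)
  qed
  moreover have fin: "finsum_vec TYPE(complex) n f S \<in> carrier_vec n"
    using f by (intro finsum_vec_closed) auto
  ultimately show ?thesis
    using mult_add_distrib_mat_vec[OF A u, of "z \<cdot>\<^sub>v finsum_vec TYPE(complex) n f S"]
      mult_mat_vec[OF A fin] by simp
qed

subsection \<open>Hermitian forms and symplectic Runge-Kutta weights\<close>

text \<open>For Hermitian \<open>A\<close> the real part makes this a symmetric form, bilinear over
  the reals. Real linearity is enough because the time step and the Runge-Kutta coefficients are
  real.\<close>

definition re_form :: "complex mat \<Rightarrow> complex vec \<Rightarrow> complex vec \<Rightarrow> real" where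
  "re_form A u v = Re ((A *\<^sub>v u) \<bullet>c v)"

lemma re_form_add_left:
  assumes "A \<in> carrier_mat n n" "u \<in> carrier_vec n" "v \<in> carrier_vec n" "w \<in> carrier_vec n"
  shows "re_form A (u + v) w = re_form A u w + re_form A v w"
  using assms by (simp add: re_form_def mult_add_distrib_mat_vec[of _ n n] add_scalar_prod_distrib[of _ n])

lemma re_form_smult_left:
  assumes "A \<in> carrier_mat n n" "u \<in> carrier_vec n" "w \<in> carrier_vec n"
  shows "re_form A (complex_of_real r \<cdot>\<^sub>v u) w = r * re_form A u w"
  using assms by (simp add: re_form_def mult_mat_vec[of _ n n] smult_scalar_prod_distrib[of _ n])

lemma re_form_zero_left:
  assumes "A \<in> carrier_mat n n" "w \<in> carrier_vec n"
  shows "re_form A (0\<^sub>v n) w = 0"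
proof -
  have "complex_of_real 0 \<cdot>\<^sub>v 0\<^sub>v n = 0\<^sub>v n"
    by (intro eq_vecI) auto
  with re_form_smult_left[of A n "0\<^sub>v n" w 0] assms show ?thesis
    by (metis mult_zero_left zero_carrier_vec)
qed

lemma re_form_finsum_left:
  assumes A: "A \<in> carrier_mat n n" and w: "w \<in> carrier_vec n" and "finite S"
    and f: "\<And>x. x \<in> S \<Longrightarrow> f x \<in> carrier_vec n"
  shows "re_form A (finsum_vec TYPE(complex) n f S) w = (\<Sum>x\<in>S. re_form A (f x) w)"
  using \<open>finite S\<close> f
proof (induction S rule: finite_induct)
  case empty
  then show ?case
    using re_form_zero_left[OF A w] by (simp add: finsum_vec_empty)
next
  case (insert x S)
  then have x: "f x \<in> carrier_vec n" and f: "f \<in> S \<rightarrow> carrier_vec n"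
    by auto
  have "re_form A (f x + finsum_vec TYPE(complex) n f S) w =
      re_form A (f x) w + re_form A (finsum_vec TYPE(complex) n f S) w"
    by (rule re_form_add_left[OF A x finsum_vec_closed[OF f] w])
  with insert x f show ?case
    by (simp add: finsum_vec_insert)
qed

text \<open>Moving \<open>A\<close> to the other argument and exchanging the arguments conjugates
  the product, and the real part does not see that.\<close>

lemma re_form_sym:
  assumes A: "A \<in> carrier_mat n n"
    and herm: "\<And>i j. i < n \<Longrightarrow> j < n \<Longrightarrow> A $$ (j, i) = cnj (A $$ (i, j))"
    and u: "u \<in> carrier_vec n" and v: "v \<in> carrier_vec n"
  shows "re_form A u v = re_form A v u"
proof -
  have "(A *\<^sub>v u) \<bullet>c v = u \<bullet>c (A *\<^sub>v v)"
    by (rule cscalar_prod_mult_mat_vec[OF A A herm u v])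
  also have "\<dots> = conjugate ((A *\<^sub>v v) \<bullet>c u)"
    using A u v by (simp add: scalar_prod_def cnj_sum ac_simps)
  finally show ?thesis
    by (simp add: re_form_def)
qed

text \<open>For imaginary \<open>z\<close> and Hermitian \<open>A\<close> the exponential is
  unitary, and it commutes with \<open>A\<close>.\<close>

lemma re_form_mat_exp_invariant:
  assumes A: "A \<in> carrier_mat n n"
    and herm: "\<And>i j. i < n \<Longrightarrow> j < n \<Longrightarrow> A $$ (j, i) = cnj (A $$ (i, j))"
    and u: "u \<in> carrier_vec n" and v: "v \<in> carrier_vec n"
    and z: "cnj z = - z"
  shows "re_form A (mat_exp (z \<cdot>\<^sub>m A) *\<^sub>v u) (mat_exp (z \<cdot>\<^sub>m A) *\<^sub>v v) = re_form A u v"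
proof -
  let ?G = "mat_exp (z \<cdot>\<^sub>m A)" and ?H = "mat_exp (- z \<cdot>\<^sub>m A)"
  have G: "?G \<in> carrier_mat n n" and H: "?H \<in> carrier_mat n n"
    using A by auto
  have adj: "?G $$ (j, i) = cnj (?H $$ (i, j))" if "i < n" "j < n" for i j
    using mat_exp_smult_hermitian[OF A herm that, of "- z"] z by simp
  have HG: "?H * ?G = 1\<^sub>m n"
    using mat_exp_add_smult[OF A, of "- z" z] mat_exp_zero_smult[OF A] by simp
  \<comment> \<open>The identity \<open>?H * ?G\<close> is inserted so that \<open>?H\<close> can be
    moved to the second argument, where it becomes its adjoint \<open>?G\<close>.\<close>
  have "(A *\<^sub>v u) \<bullet>c v = ((?H * ?G) *\<^sub>v (A *\<^sub>v u)) \<bullet>c v"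
    unfolding HG using A u by simp
  also have "\<dots> = (?H *\<^sub>v (?G *\<^sub>v (A *\<^sub>v u))) \<bullet>c v"
    using assoc_mult_mat_vec[OF H G, of "A *\<^sub>v u"] A u by simp
  also have "\<dots> = (?G *\<^sub>v (A *\<^sub>v u)) \<bullet>c (?G *\<^sub>v v)"
    by (rule cscalar_prod_mult_mat_vec[OF H G adj
          mult_mat_vec_carrier[OF G mult_mat_vec_carrier[OF A u]] v])
  also have "?G *\<^sub>v (A *\<^sub>v u) = A *\<^sub>v (?G *\<^sub>v u)"
    using assoc_mult_mat_vec[OF G A u] assoc_mult_mat_vec[OF A G u] mat_exp_smult_commute[OF A, of z]
    by simp
  finally show ?thesis
    by (simp add: re_form_def)
qed

text \<open>The condition splits \<open>b i * b j\<close> into two terms. The resulting double sums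
  agree: symmetry of \<open>R\<close> rearranges the first, and exchanging the order of summation
  the second.\<close>

lemma symplectic_weights_sum:
  fixes a :: "'i \<Rightarrow> 'i \<Rightarrow> real"
  assumes sympl: "\<And>i j. i \<in> S \<Longrightarrow> j \<in> S \<Longrightarrow> b i * a i j + b j * a j i = b i * b j"
    and sym: "\<And>i j. i \<in> S \<Longrightarrow> j \<in> S \<Longrightarrow> R i j = R j i"
  shows "(\<Sum>i\<in>S. \<Sum>j\<in>S. b i * b j * R i j) = 2 * (\<Sum>i\<in>S. b i * (\<Sum>j\<in>S. a i j * R j i))"
proof -
  have "(\<Sum>i\<in>S. \<Sum>j\<in>S. b i * b j * R i j) =
      (\<Sum>i\<in>S. \<Sum>j\<in>S. b i * (a i j * R j i)) + (\<Sum>i\<in>S. \<Sum>j\<in>S. b j * (a j i * R i j))"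
    unfolding sum.distrib[symmetric]
    by (intro sum.cong refl) (simp add: sympl[symmetric] sym distrib_right)
  also have "(\<Sum>i\<in>S. \<Sum>j\<in>S. b j * (a j i * R i j)) = (\<Sum>i\<in>S. \<Sum>j\<in>S. b i * (a i j * R j i))"
    by (rule sum.swap)
  finally show ?thesis
    by (simp add: sum_distrib_left)
qed

text \<open>The square of the increment is of second order in \<tau>; by the weights it becomes
  precisely the correction that replaces \<open>p\<close> by the stage values.\<close>

lemma symplectic_step_square:
  fixes p :: real
  assumes sympl: "\<And>i j. i \<in> S \<Longrightarrow> j \<in> S \<Longrightarrow> b i * a i j + b j * a j i = b i * b j"
  shows "(p + \<tau> * (\<Sum>i\<in>S. b i * l i))\<^sup>2 =
    p\<^sup>2 + 2 * \<tau> * (\<Sum>i\<in>S. b i * ((p + \<tau> * (\<Sum>j\<in>S. a i j * l j)) * l i))"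
proof -
  have "(\<Sum>i\<in>S. b i * l i)\<^sup>2 = (\<Sum>i\<in>S. \<Sum>j\<in>S. b i * b j * (l i * l j))"
    by (simp add: power2_eq_square sum_product ac_simps)
  also have "\<dots> = 2 * (\<Sum>i\<in>S. b i * (\<Sum>j\<in>S. a i j * (l j * l i)))"
    using sympl by (intro symplectic_weights_sum) auto
  finally have sq: "(\<Sum>i\<in>S. b i * l i)\<^sup>2 = 2 * (\<Sum>i\<in>S. b i * ((\<Sum>j\<in>S. a i j * l j) * l i))"
    by (simp add: sum_distrib_right mult.assoc)
  have "(\<Sum>i\<in>S. b i * ((p + \<tau> * (\<Sum>j\<in>S. a i j * l j)) * l i)) =
      p * (\<Sum>i\<in>S. b i * l i) + \<tau> * (\<Sum>i\<in>S. b i * ((\<Sum>j\<in>S. a i j * l j) * l i))"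
    unfolding sum_distrib_left[of p] sum_distrib_left[of \<tau>] sum.distrib[symmetric]
    by (intro sum.cong refl) (simp add: algebra_simps sum_distrib_left)
  then show ?thesis
    by (simp add: power2_sum power_mult_distrib sq) (simp add: power2_eq_square algebra_simps)
qed

text \<open>The same mechanism as for the square, with the product of numbers replaced by a
  symmetric form on vectors.\<close>

lemma symplectic_step_re_form:
  assumes A: "A \<in> carrier_mat n n"
    and herm: "\<And>i j. i < n \<Longrightarrow> j < n \<Longrightarrow> A $$ (j, i) = cnj (A $$ (i, j))"
    and u: "u \<in> carrier_vec n" and "finite S"
    and w: "\<And>i. i \<in> S \<Longrightarrow> w i \<in> carrier_vec n"
    and sympl: "\<And>i j. i \<in> S \<Longrightarrow> j \<in> S \<Longrightarrow> b i * a i j + b j * a j i = b i * b j"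
    and U: "\<And>i. i \<in> S \<Longrightarrow> U i = u + complex_of_real \<tau> \<cdot>\<^sub>v
      finsum_vec TYPE(complex) n (\<lambda>j. complex_of_real (a i j) \<cdot>\<^sub>v w j) S"
    and u': "u' = u + complex_of_real \<tau> \<cdot>\<^sub>v
      finsum_vec TYPE(complex) n (\<lambda>j. complex_of_real (b j) \<cdot>\<^sub>v w j) S"
  shows "re_form A u' u' = re_form A u u + 2 * \<tau> * (\<Sum>i\<in>S. b i * re_form A (U i) (w i))"
proof -
  have fs: "finsum_vec TYPE(complex) n (\<lambda>j. complex_of_real (\<gamma> j) \<cdot>\<^sub>v w j) S \<in> carrier_vec n" for \<gamma>
    using w by (intro finsum_vec_closed) auto
  have comb: "re_form A (u + complex_of_real \<tau> \<cdot>\<^sub>v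
        finsum_vec TYPE(complex) n (\<lambda>j. complex_of_real (\<gamma> j) \<cdot>\<^sub>v w j) S) x =
      re_form A u x + \<tau> * (\<Sum>j\<in>S. \<gamma> j * re_form A (w j) x)" if x: "x \<in> carrier_vec n" for \<gamma> x
    using A u x w \<open>finite S\<close> fs
    by (simp add: re_form_add_left[of _ n] re_form_smult_left[of _ n] re_form_finsum_left[of _ n])
  have u'_carrier: "u' \<in> carrier_vec n"
    unfolding u' using u fs by simp
  note sym = re_form_sym[OF A herm]
  \<comment> \<open>The step is expanded in powers of \<tau>: \<open>q\<close> carries the
    first-order terms, and the Gram matrix \<open>R\<close> of the increments the second-order
    ones.\<close>
  define R where "R i j = re_form A (w i) (w j)" for i j
  define q where "q i = re_form A u (w i)" for i
  \<comment> \<open>Expansion is available in the first argument only, so the second is reached by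
    symmetry.\<close>
  have wu': "re_form A (w i) u' = q i + \<tau> * (\<Sum>j\<in>S. b j * R i j)" if "i \<in> S" for i
  proof -
    have "re_form A (w i) u' = re_form A u' (w i)"
      using that w u'_carrier by (intro sym)
    also have "\<dots> = q i + \<tau> * (\<Sum>j\<in>S. b j * R j i)"
      unfolding u' q_def R_def using comb[of "w i" b] that w by simp
    also have "(\<Sum>j\<in>S. b j * R j i) = (\<Sum>j\<in>S. b j * R i j)"
      unfolding R_def using that w sym by (intro sum.cong refl) metis
    finally show ?thesis .
  qed
  have "re_form A u' u' = re_form A u u' + \<tau> * (\<Sum>i\<in>S. b i * re_form A (w i) u')"
    using comb[OF u'_carrier, of b] unfolding u'[symmetric] .
  also have "re_form A u u' = re_form A u' u"
    using u u'_carrier by (intro sym)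
  also have "\<dots> = re_form A u u + \<tau> * (\<Sum>i\<in>S. b i * q i)"
    unfolding u' comb[OF u] q_def using u w sym by (auto intro!: sum.cong)
  also have "(\<Sum>i\<in>S. b i * re_form A (w i) u') =
      (\<Sum>i\<in>S. b i * q i) + \<tau> * (\<Sum>i\<in>S. \<Sum>j\<in>S. b i * b j * R i j)"
    using wu' by (simp add: distrib_left sum.distrib sum_distrib_left ac_simps)
  also have "(\<Sum>i\<in>S. \<Sum>j\<in>S. b i * b j * R i j) = 2 * (\<Sum>i\<in>S. b i * (\<Sum>j\<in>S. a i j * R j i))"
    using sympl w sym unfolding R_def by (intro symplectic_weights_sum) auto
  finally have "re_form A u' u' = re_form A u u +
      2 * \<tau> * ((\<Sum>i\<in>S. b i * q i) + \<tau> * (\<Sum>i\<in>S. b i * (\<Sum>j\<in>S. a i j * R j i)))"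
    by (simp add: algebra_simps)
  \<comment> \<open>The rewritten second-order sum turns \<open>u\<close> in \<open>q i\<close> into
    the stage value \<open>U i\<close>.\<close>
  also have "(\<Sum>i\<in>S. b i * q i) + \<tau> * (\<Sum>i\<in>S. b i * (\<Sum>j\<in>S. a i j * R j i)) =
      (\<Sum>i\<in>S. b i * re_form A (U i) (w i))"
    unfolding sum_distrib_left[of \<tau>] sum.distrib[symmetric]
    using U comb w by (intro sum.cong refl) (simp add: q_def R_def algebra_simps)
  finally show ?thesis .
qed

subsection \<open>The spectral Laplacian and the grid inner product\<close>

lemma spectral_D2_carrier: "spectral_D2 l N \<in> carrier_mat N N"
  by (simp add: spectral_D2_def Let_def)

text \<open>Exchanging the indices changes only the sign of the sine, which is squared.\<close>

lemma spectral_D2_sym: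
  assumes "i < N" "j < N"
  shows "spectral_D2 l N $$ (j, i) = spectral_D2 l N $$ (i, j)"
proof -
  have "sin (x * ((y - z) / 2)) = - sin (x * ((z - y) / 2))" for x y z :: real
  proof -
    have "x * ((y - z) / 2) = - (x * ((z - y) / 2))"
      by (simp add: field_simps)
    then show ?thesis
      by (simp only: sin_minus)
  qed
  from this[of "2 * pi / l" "grid_pt l N j" "grid_pt l N i"]
  have "(sin (2 * pi / l * ((grid_pt l N j - grid_pt l N i) / 2)))\<^sup>2 =
      (sin (2 * pi / l * ((grid_pt l N i - grid_pt l N j) / 2)))\<^sup>2"
    by (metis power2_minus)
  then show ?thesis
    using assms by (simp add: spectral_D2_def Let_def add.commute[of j i] power_divide)
qed

lemma spectral_Lap_carrier: "spectral_Lap lx ly Nx Ny \<in> carrier_mat (Nx * Ny) (Nx * Ny)"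
  using spectral_D2_carrier[of lx Nx] spectral_D2_carrier[of ly Ny]
  by (auto simp: spectral_Lap_def kronecker_def mult.commute)

text \<open>The entries are real, and both Kronecker summands inherit the symmetry of the
  one-dimensional matrices.\<close>

lemma spectral_Lap_hermitian:
  assumes "i < Nx * Ny" "j < Nx * Ny"
  shows "spectral_Lap lx ly Nx Ny $$ (j, i) = cnj (spectral_Lap lx ly Nx Ny $$ (i, j))"
proof -
  \<comment> \<open>Position \<open>i\<close> has x-index \<open>i mod Nx\<close> and y-index
    \<open>i div Nx\<close>; the existence of such a position already forces \<open>Nx\<close> to be
    positive.\<close>
  have "i mod Nx < Nx" "j mod Nx < Nx" "i div Nx < Ny" "j div Nx < Ny"
    using assms by (auto simp: less_mult_imp_div_less mult.commute intro!: mod_less_divisor gr0I)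
  then show ?thesis
    using assms spectral_D2_carrier[of lx Nx] spectral_D2_carrier[of ly Ny]
    by (simp add: spectral_Lap_def kronecker_def mult.commute[of Ny] spectral_D2_sym)
qed

text \<open>For fixed \<open>k\<close> the grid values fill a block of \<open>Nx\<close> consecutive
  positions, and these blocks together exhaust the vector.\<close>

lemma grid_inner_eq_cscalar_prod:
  assumes "u \<in> carrier_vec (Nx * Ny)" "v \<in> carrier_vec (Nx * Ny)"
  shows "grid_inner lx ly Nx Ny u v = complex_of_real (lx / real Nx * (ly / real Ny)) * (u \<bullet>c v)"
proof -
  have "(\<Sum>j<Nx. \<Sum>k<Ny. u $ (j + k * Nx) * cnj (v $ (j + k * Nx))) =
      (\<Sum>k<Ny. \<Sum>j<Nx. u $ (j + k * Nx) * cnj (v $ (j + k * Nx)))"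
    by (rule sum.swap)
  also have "\<dots> = (\<Sum>k<Ny. \<Sum>r = k * Nx..<k * Nx + Nx. u $ r * cnj (v $ r))"
  proof (rule sum.cong)
    show "(\<Sum>j<Nx. u $ (j + k * Nx) * cnj (v $ (j + k * Nx))) =
        (\<Sum>r = k * Nx..<k * Nx + Nx. u $ r * cnj (v $ r))" for k
      using sum.shift_bounds_nat_ivl[of "\<lambda>r. u $ r * cnj (v $ r)" 0 "k * Nx" Nx]
      by (simp add: lessThan_atLeast0 add.commute[of Nx])
  qed simp
  also have "\<dots> = (\<Sum>r<Ny * Nx. u $ r * cnj (v $ r))"
    by (rule sum.nat_group)
  also have "\<dots> = u \<bullet>c v"
    using assms by (simp add: scalar_prod_def lessThan_atLeast0 mult.commute)
  finally show ?thesis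
    by (simp add: grid_inner_def)
qed

lemma grid_energy_eq:
  assumes u: "u \<in> carrier_vec (Nx * Ny)"
  shows "grid_energy lx ly Nx Ny \<beta> C0 u p = complex_of_real
    (lx / real Nx * (ly / real Ny) * re_form (spectral_Lap lx ly Nx Ny) u u + \<beta> / 2 * p\<^sup>2 - \<beta> / 2 * C0)"
proof -
  let ?L = "spectral_Lap lx ly Nx Ny"
  \<comment> \<open>The product turns out to equal its own conjugate, hence it is real and no
    information is lost in \<open>re_form\<close>.\<close>
  have "(?L *\<^sub>v u) \<bullet>c u = u \<bullet>c (?L *\<^sub>v u)"
    by (rule cscalar_prod_mult_mat_vec[OF spectral_Lap_carrier spectral_Lap_carrier
          spectral_Lap_hermitian u u])
  also have "\<dots> = cnj ((?L *\<^sub>v u) \<bullet>c u)"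
    using spectral_Lap_carrier[of lx ly Nx Ny] u by (simp add: scalar_prod_def cnj_sum ac_simps)
  finally have "(?L *\<^sub>v u) \<bullet>c u = complex_of_real (re_form ?L u u)"
    by (simp add: re_form_def complex_eq_iff)
  then show ?thesis
    using spectral_Lap_carrier[of lx ly Nx Ny] u
    by (simp add: grid_energy_def grid_inner_eq_cscalar_prod)
qed

section \<open>Energy conservation for the integrating factor scheme\<close>

theorem theorem3p2:
  fixes xl xr yl yr lx ly :: real and Nx Ny m :: nat
    and \<beta> C0 \<tau> :: real
    and s :: nat and a :: "nat \<Rightarrow> nat \<Rightarrow> real" and b c :: "nat \<Rightarrow> real"
    and L :: "complex mat" and G :: "real \<Rightarrow> complex mat"
    and \<phi> :: "nat \<Rightarrow> complex vec" and p :: "nat \<Rightarrow> real"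
    and \<Phi> \<Phi>star k :: "nat \<Rightarrow> nat \<Rightarrow> complex vec" and P l :: "nat \<Rightarrow> nat \<Rightarrow> real"
    and sel :: "nat \<Rightarrow> data_label set"
  assumes domain: "xl < xr" "yl < yr" "lx = xr - xl" "ly = yr - yl"
    and grid: "even Nx" "Nx > 0" "even Ny" "Ny > 0" "m = Nx * Ny"
    and L: "L = spectral_Lap lx ly Nx Ny"
    and G: "\<And>\<theta>. G \<theta> = mat_exp ((\<i> * complex_of_real \<theta>) \<cdot>\<^sub>m L)"
    and params: "\<tau> > 0" "C0 \<ge> 0"
    and stages: "s \<ge> 1" "\<And>i. i \<in> {1..s} \<Longrightarrow> c i = (\<Sum>j=1..s. a i j)" "inj_on c {1..s}"
    and dims: "\<And>n. \<phi> n \<in> carrier_vec m"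
      "\<And>n i. i \<in> {1..s} \<Longrightarrow> \<Phi> n i \<in> carrier_vec m"
      "\<And>n i. i \<in> {1..s} \<Longrightarrow> k n i \<in> carrier_vec m"
    and selection: "\<And>n. sel n \<subseteq> available_data s n" "\<And>n. sel n \<noteq> {}"
      "\<And>n. inj_on (data_time \<tau> c) (sel n)"
    and extrapolation: "\<And>n i. i \<in> {1..s} \<Longrightarrow>
      \<Phi>star n i = lagrange_interp m (sel n) (data_time \<tau> c) (data_value \<phi> \<Phi>)
                    (real n * \<tau> + c i * \<tau>)"
    and radicand_pos: "\<And>n i. i \<in> {1..s} \<Longrightarrow> radicand lx ly Nx Ny C0 (\<Phi>star n i) > 0"
    and stage_phi: "\<And>n i. i \<in> {1..s} \<Longrightarrow>
      \<Phi> n i = G (c i * \<tau>) *\<^sub>v \<phi> n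
        + complex_of_real \<tau> \<cdot>\<^sub>v finsum_vec TYPE(complex) m
            (\<lambda>j. complex_of_real (a i j) \<cdot>\<^sub>v (G ((c i - c j) * \<tau>) *\<^sub>v k n j)) {1..s}"
    and stage_p: "\<And>n i. i \<in> {1..s} \<Longrightarrow> P n i = p n + \<tau> * (\<Sum>j=1..s. a i j * l n j)"
    and stage_k: "\<And>n i. i \<in> {1..s} \<Longrightarrow>
      k n i = (\<i> * complex_of_real (\<beta> * P n i)) \<cdot>\<^sub>v normalized_cubic lx ly Nx Ny C0 (\<Phi>star n i)"
    and stage_l: "\<And>n i. i \<in> {1..s} \<Longrightarrow>
      l n i = 2 * Re (grid_inner lx ly Nx Ny (\<i> \<cdot>\<^sub>v (L *\<^sub>v \<Phi> n i))
                        (normalized_cubic lx ly Nx Ny C0 (\<Phi>star n i)))"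
    and step_phi: "\<And>n. \<phi> (Suc n) = G \<tau> *\<^sub>v \<phi> n
        + complex_of_real \<tau> \<cdot>\<^sub>v finsum_vec TYPE(complex) m
            (\<lambda>i. complex_of_real (b i) \<cdot>\<^sub>v (G ((1 - c i) * \<tau>) *\<^sub>v k n i)) {1..s}"
    and step_p: "\<And>n. p (Suc n) = p n + \<tau> * (\<Sum>i=1..s. b i * l n i)"
    and symplectic: "\<And>i j. i \<in> {1..s} \<Longrightarrow> j \<in> {1..s} \<Longrightarrow>
      b i * a i j + b j * a j i = b i * b j"
  shows "\<forall>n. grid_energy lx ly Nx Ny \<beta> C0 (\<phi> n) (p n)
           = grid_energy lx ly Nx Ny \<beta> C0 (\<phi> 0) (p 0)"
proof -
  \<comment> \<open>The area of a grid cell, which is the factor between the scalar product of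
    vectors and the grid inner product.\<close>
  define h where "h = lx / real Nx * (ly / real Ny)"
  have L_carrier: "L \<in> carrier_mat m m"
    unfolding L grid(5) by (rule spectral_Lap_carrier)
  have L_herm: "L $$ (j, i) = cnj (L $$ (i, j))" if "i < m" "j < m" for i j
    using that unfolding L grid(5) by (rule spectral_Lap_hermitian)
  have G_carrier: "G \<theta> \<in> carrier_mat m m" for \<theta>
    using L_carrier by (simp add: G)
  have G_add: "G (x + y) = G x * G y" for x y
    using mat_exp_add_smult[OF L_carrier, of "\<i> * x" "\<i> * y"] by (simp add: G distrib_left)
  have G_add_vec: "G (x + y) *\<^sub>v v = G x *\<^sub>v (G y *\<^sub>v v)" if "v \<in> carrier_vec m" for x y v
    unfolding G_add using assoc_mult_mat_vec[OF G_carrier G_carrier that] .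
  have G_zero_vec: "G 0 *\<^sub>v v = v" if "v \<in> carrier_vec m" for v
    using mat_exp_zero_smult[OF L_carrier] that by (simp add: G)
  have G_form: "re_form L (G \<theta> *\<^sub>v u) (G \<theta> *\<^sub>v v) = re_form L u v"
    if "u \<in> carrier_vec m" "v \<in> carrier_vec m" for \<theta> u v
    unfolding G by (rule re_form_mat_exp_invariant[OF L_carrier L_herm that]) auto
  have step: "h * re_form L (\<phi> (Suc n)) (\<phi> (Suc n)) + \<beta> / 2 * (p (Suc n))\<^sup>2 =
      h * re_form L (\<phi> n) (\<phi> n) + \<beta> / 2 * (p n)\<^sup>2" for n
  proof -
    \<comment> \<open>The increments are pulled back to time \<open>n * \<tau>\<close>. In these
      variables \<open>comb (a i)\<close> is the stage and \<open>comb b\<close> the step of an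
      ordinary Runge-Kutta method.\<close>
    define w where "w i = G (- (c i * \<tau>)) *\<^sub>v k n i" for i
    define comb where "comb \<gamma> = \<phi> n + complex_of_real \<tau> \<cdot>\<^sub>v
      finsum_vec TYPE(complex) m (\<lambda>j. complex_of_real (\<gamma> j) \<cdot>\<^sub>v w j) {1..s}" for \<gamma>
    have w_carrier: "w i \<in> carrier_vec m" if "i \<in> {1..s}" for i
      unfolding w_def by (rule mult_mat_vec_carrier[OF G_carrier dims(3)[OF that]])
    have comb_carrier: "comb \<gamma> \<in> carrier_vec m" for \<gamma>
      unfolding comb_def using dims(1) w_carrier
      by (intro add_carrier_vec[OF dims(1)] smult_carrier_vec[THEN iffD2] finsum_vec_closed) auto
    have G_w: "G \<theta> *\<^sub>v w i = G (\<theta> - c i * \<tau>) *\<^sub>v k n i" if "i \<in> {1..s}" for \<theta> i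
      unfolding w_def using G_add_vec[OF dims(3)[OF that], of \<theta> "- (c i * \<tau>)"] by simp
    \<comment> \<open>By the group law the exponents become \<open>\<theta> - c j * \<tau>\<close>.
      The choices \<open>c i * \<tau>\<close> and \<open>\<tau>\<close> for \<open>\<theta>\<close>
      give back the stages and the step of the scheme.\<close>
    have G_comb: "G \<theta> *\<^sub>v comb \<gamma> = G \<theta> *\<^sub>v \<phi> n + complex_of_real \<tau> \<cdot>\<^sub>v
        finsum_vec TYPE(complex) m
          (\<lambda>j. complex_of_real (\<gamma> j) \<cdot>\<^sub>v (G (\<theta> - c j * \<tau>) *\<^sub>v k n j)) {1..s}" for \<theta> \<gamma>
    proof -
      have "finsum_vec TYPE(complex) m (\<lambda>j. G \<theta> *\<^sub>v (complex_of_real (\<gamma> j) \<cdot>\<^sub>v w j)) {1..s} =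
          finsum_vec TYPE(complex) m
            (\<lambda>j. complex_of_real (\<gamma> j) \<cdot>\<^sub>v (G (\<theta> - c j * \<tau>) *\<^sub>v k n j)) {1..s}"
        (is "finsum_vec _ _ ?f _ = finsum_vec _ _ ?g _")
      proof (rule finsum_vec_cong)
        show "?g \<in> {1..s} \<rightarrow> carrier_vec m"
          by (intro Pi_I smult_carrier_vec[THEN iffD2] mult_mat_vec_carrier[OF G_carrier dims(3)])
        show "?f j = ?g j" if "j \<in> {1..s}" for j
          using mult_mat_vec[OF G_carrier w_carrier[OF that]] G_w[OF that] by simp
      qed simp
      moreover have "G \<theta> *\<^sub>v comb \<gamma> = G \<theta> *\<^sub>v \<phi> n + complex_of_real \<tau> \<cdot>\<^sub>v
          finsum_vec TYPE(complex) m (\<lambda>j. G \<theta> *\<^sub>v (complex_of_real (\<gamma> j) \<cdot>\<^sub>v w j)) {1..s}"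
        unfolding comb_def using w_carrier
        by (intro mult_mat_vec_add_smult_finsum[OF G_carrier dims(1)]) auto
      ultimately show ?thesis
        by simp
    qed
    have \<Phi>_eq: "\<Phi> n i = G (c i * \<tau>) *\<^sub>v comb (a i)" if "i \<in> {1..s}" for i
      unfolding G_comb stage_phi[OF that] by (simp add: left_diff_distrib)
    have \<phi>_Suc_eq: "\<phi> (Suc n) = G \<tau> *\<^sub>v comb b"
      unfolding G_comb step_phi by (simp add: left_diff_distrib)
    \<comment> \<open>Both \<open>k n i\<close> and \<open>l n i\<close> are built from the same
      vector \<open>f\<close>. The imaginary unit stands in the second argument for one and in the
      first for the other, so both yield the same imaginary part, with opposite signs.\<close>
    have exchange: "h * re_form L (comb (a i)) (w i) = - (\<beta> / 2 * (P n i * l n i))" if i: "i \<in> {1..s}" for i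
    proof -
      define f where "f = normalized_cubic lx ly Nx Ny C0 (\<Phi>star n i)"
      have k: "k n i = (\<i> * complex_of_real (\<beta> * P n i)) \<cdot>\<^sub>v f"
        unfolding f_def by (rule stage_k[OF i])
      \<comment> \<open>Scaling keeps the length of a vector, so the dimension of \<open>f\<close>
        can be read off from \<open>k n i\<close>.\<close>
      then have f_carrier: "f \<in> carrier_vec m"
        using dims(3)[OF i, of n] by simp
      have L\<Phi>: "L *\<^sub>v \<Phi> n i \<in> carrier_vec m"
        by (rule mult_mat_vec_carrier[OF L_carrier dims(2)[OF i]])
      have "re_form L (comb (a i)) (w i) = re_form L (\<Phi> n i) (G (c i * \<tau>) *\<^sub>v w i)"
        unfolding \<Phi>_eq[OF i] by (rule G_form[OF comb_carrier w_carrier[OF i], symmetric])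
      also have "G (c i * \<tau>) *\<^sub>v w i = k n i"
        using G_w[OF i] G_zero_vec[OF dims(3)[OF i]] by simp
      also have "re_form L (\<Phi> n i) (k n i) = \<beta> * P n i * Im ((L *\<^sub>v \<Phi> n i) \<bullet>c f)"
        using L\<Phi> f_carrier
        by (simp add: re_form_def k conjugate_smult_vec scalar_prod_smult_distrib[of _ m])
      finally have "re_form L (comb (a i)) (w i) = \<beta> * P n i * Im ((L *\<^sub>v \<Phi> n i) \<bullet>c f)" .
      moreover have "l n i = - (2 * h * Im ((L *\<^sub>v \<Phi> n i) \<bullet>c f))"
        using L\<Phi> f_carrier unfolding stage_l[OF i] f_def[symmetric] h_def
        by (simp add: grid_inner_eq_cscalar_prod grid(5) smult_scalar_prod_distrib[of _ "Nx * Ny"])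
      ultimately show ?thesis
        by simp
    qed
    have "re_form L (\<phi> (Suc n)) (\<phi> (Suc n)) = re_form L (comb b) (comb b)"
      unfolding \<phi>_Suc_eq by (rule G_form[OF comb_carrier comb_carrier])
    also have "\<dots> = re_form L (\<phi> n) (\<phi> n) +
        2 * \<tau> * (\<Sum>i = 1..s. b i * re_form L (comb (a i)) (w i))"
      by (rule symplectic_step_re_form[OF L_carrier L_herm dims(1) finite_atLeastAtMost w_carrier
            symplectic comb_def comb_def])
    \<comment> \<open>The factor \<open>h\<close> is taken inside the sum so that
      \<open>exchange\<close> applies to each stage.\<close>
    finally have "h * re_form L (\<phi> (Suc n)) (\<phi> (Suc n)) = h * re_form L (\<phi> n) (\<phi> n) +
        2 * \<tau> * (\<Sum>i = 1..s. b i * (h * re_form L (comb (a i)) (w i)))"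
      by (simp add: algebra_simps sum_distrib_left)
    also have "(\<Sum>i = 1..s. b i * (h * re_form L (comb (a i)) (w i))) =
        - (\<beta> / 2 * (\<Sum>i = 1..s. b i * (P n i * l n i)))"
      unfolding sum_distrib_left sum_negf[symmetric] by (intro sum.cong refl) (simp add: exchange)
    \<comment> \<open>The increment of \<open>\<beta> / 2\<close> times the square of
      \<open>p\<close> is the same sum over the stages with the opposite sign.\<close>
    finally show ?thesis
      using symplectic_step_square[of "{1..s}" b a "p n" \<tau> "l n", OF symplectic]
      by (simp add: step_p stage_p algebra_simps)
  qed
  have "h * re_form L (\<phi> n) (\<phi> n) + \<beta> / 2 * (p n)\<^sup>2 =
      h * re_form L (\<phi> 0) (\<phi> 0) + \<beta> / 2 * (p 0)\<^sup>2" for n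
  proof (induction n)
    case (Suc n)
    with step[of n] show ?case
      by simp
  qed simp
  \<comment> \<open>The energy differs from the conserved real quantity only by the constant
    \<open>\<beta> / 2 * C0\<close>.\<close>
  moreover have "grid_energy lx ly Nx Ny \<beta> C0 (\<phi> n) (p n) = complex_of_real
      (h * re_form L (\<phi> n) (\<phi> n) + \<beta> / 2 * (p n)\<^sup>2 - \<beta> / 2 * C0)" for n
    unfolding h_def L by (rule grid_energy_eq[OF dims(1)[unfolded grid(5)]])
  ultimately show ?thesis
    by metis
qed

end
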